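(* Let $$\Delta t_{\mathrm{CFL}}=\frac{2}{\frac{2\hbar}{m}\left(\frac{1}{(\Delta x)^2}+\frac{1}{(\Delta y)^2}+\frac{1}{(\Delta z)^2}\right)+\frac{\max_{i,j,k}|U_{i,j,k}|}{\hbar}}$$ and $$\Delta t_{\mathrm{CFL,gen}}=\frac{2}{\rho\!\left(\frac{1}{\hbar}(D_V'')^{-1/2}H(D_V'')^{-1/2}\right)},$$ where $\rho(\cdot)$ is the spectral radius. Then $\Delta t_{\mathrm{CFL}}\le\Delta t_{\mathrm{CFL,gen}}$.
   Context: Fix constants $\hbar>0$, $m>0$, cell sizes $\Delta x,\Delta y,\Delta z>0$ and positive integers $n_x,n_y,n_z$. The region is a box of $n_x\times n_y\times n_z$ primary cells of size $\Delta x\times\Delta y\times\Delta z$ with primary nodes $(i,j,k)$, $1\le i\le n_x+1$, $1\le j\le n_y+1$, $1\le k\le n_z+1$. Let $N=(n_x+1)(n_y+1)(n_z+1)$; node-indexed vectors use the ordering $i+(j-1)(n_x+1)+(k-1)(n_x+1)(n_y+1)$. Real potential values $U_{i,j,k}$ are given at the nodes; $D_U$ is the $N\times N$ diagonal matrix containing them. Let $I_p$ be the $p\times p$ identity, $\tilde I_p=\mathrm{diag}(\tfrac12,1,\dots,1,\tfrac12)$ ($p\times p$), $W_p=[0_{p\times1}\ I_p]-[I_p\ 0_{p\times 1}]$ ($p\times(p+1)$), $\otimes$ the Kronecker product. Define $D_V''=\Delta x\Delta y\Delta z\,\tilde I_{n_z+1}\otimes\tilde I_{n_y+1}\otimes\tilde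 I_{n_x+1}$; $D=[D_x\ D_y\ D_z]$ with $D_x=-I_{n_z+1}\otimes I_{n_y+1}\otimes W_{n_x}^T$, $D_y=-I_{n_z+1}\otimes W_{n_y}^T\otimes I_{n_x+1}$, $D_z=-W_{n_z}^T\otimes I_{n_y+1}\otimes I_{n_x+1}$; $D_S''=\mathrm{diag}(\Delta y\Delta z\,\tilde I_{n_z+1}\otimes\tilde I_{n_y+1}\otimes I_{n_x},\ \Delta x\Delta z\,\tilde I_{n_z+1}\otimes I_{n_y}\otimes\tilde I_{n_x+1},\ \Delta x\Delta y\,I_{n_z}\otimes\tilde I_{n_y+1}\otimes\tilde I_{n_x+1})$; $D_l'=\mathrm{diag}(\Delta x\, I_{n_x(n_y+1)(n_z+1)},\ \Delta y\, I_{(n_x+1)n_y(n_z+1)},\ \Delta z\, I_{(n_x+1)(n_y+1)n_z})$; $H=\frac{\hbar^2}{2m}D D_S''(D_l')^{-1}D^T+D_V''D_U$. *)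

theory Defs
  imports "Jordan_Normal_Form.Spectral_Radius"
begin

definition kron :: "'a::times mat \<Rightarrow> 'a mat \<Rightarrow> 'a mat" (infixl "\<otimes>\<^sub>k" 70) where
  "kron A B = mat (dim_row A * dim_row B) (dim_col A * dim_col B)
     (\<lambda>(i,j). A $$ (i div dim_row B, j div dim_col B) * B $$ (i mod dim_row B, j mod dim_col B))"

definition tildeI :: "nat \<Rightarrow> real mat" where
  "tildeI p = mat p p (\<lambda>(i,j). if i = j then (if i = 0 \<or> i = p - 1 then 1/2 else 1) else 0)"

definition Wmat :: "nat \<Rightarrow> real mat" where
  "Wmat p = mat p (p+1) (\<lambda>(i,j). (if j = i + 1 then 1 else 0) - (if j = i then 1 else 0))"

definition hcat3 :: "real mat \<Rightarrow> real mat \<Rightarrow> real mat \<Rightarrow> real mat" where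
  "hcat3 A B C = mat (dim_row A) (dim_col A + dim_col B + dim_col C)
     (\<lambda>(i,j). if j < dim_col A then A $$ (i,j)
             else if j < dim_col A + dim_col B then B $$ (i, j - dim_col A)
             else C $$ (i, j - dim_col A - dim_col B))"

definition bdiag3 :: "real mat \<Rightarrow> real mat \<Rightarrow> real mat \<Rightarrow> real mat" where
  "bdiag3 A B C = four_block_mat A (0\<^sub>m (dim_row A) (dim_col B + dim_col C))
                                  (0\<^sub>m (dim_row B + dim_row C) (dim_col A))
                                  (four_block_mat B (0\<^sub>m (dim_row B) (dim_col C))
                                                    (0\<^sub>m (dim_row C) (dim_col B)) C)"

definition diag_inv :: "real mat \<Rightarrow> real mat" where
  "diag_inv A = mat (dim_row A) (dim_row A) (\<lambda>(i,j). if i = j then 1 / A $$ (i,i) else 0)"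

definition diag_inv_sqrt :: "real mat \<Rightarrow> real mat" where
  "diag_inv_sqrt A = mat (dim_row A) (dim_row A) (\<lambda>(i,j). if i = j then 1 / sqrt (A $$ (i,i)) else 0)"

(* the paper's matrices; indices are 0-based, node (i,j,k) (1-based) has index
   (i-1) + (j-1)(nx+1) + (k-1)(nx+1)(ny+1) *)
definition DVpp :: "real \<Rightarrow> real \<Rightarrow> real \<Rightarrow> nat \<Rightarrow> nat \<Rightarrow> nat \<Rightarrow> real mat" where
  "DVpp dx dy dz nx ny nz = (dx*dy*dz) \<cdot>\<^sub>m (tildeI (nz+1) \<otimes>\<^sub>k tildeI (ny+1) \<otimes>\<^sub>k tildeI (nx+1))"

definition Dop :: "nat \<Rightarrow> nat \<Rightarrow> nat \<Rightarrow> real mat" where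
  "Dop nx ny nz = hcat3
     (- (1\<^sub>m (nz+1) \<otimes>\<^sub>k 1\<^sub>m (ny+1) \<otimes>\<^sub>k transpose_mat (Wmat nx)))
     (- (1\<^sub>m (nz+1) \<otimes>\<^sub>k transpose_mat (Wmat ny) \<otimes>\<^sub>k 1\<^sub>m (nx+1)))
     (- (transpose_mat (Wmat nz) \<otimes>\<^sub>k 1\<^sub>m (ny+1) \<otimes>\<^sub>k 1\<^sub>m (nx+1)))"

definition DSpp :: "real \<Rightarrow> real \<Rightarrow> real \<Rightarrow> nat \<Rightarrow> nat \<Rightarrow> nat \<Rightarrow> real mat" where
  "DSpp dx dy dz nx ny nz = bdiag3
     ((dy*dz) \<cdot>\<^sub>m (tildeI (nz+1) \<otimes>\<^sub>k tildeI (ny+1) \<otimes>\<^sub>k 1\<^sub>m nx))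
     ((dx*dz) \<cdot>\<^sub>m (tildeI (nz+1) \<otimes>\<^sub>k 1\<^sub>m ny \<otimes>\<^sub>k tildeI (nx+1)))
     ((dx*dy) \<cdot>\<^sub>m (1\<^sub>m nz \<otimes>\<^sub>k tildeI (ny+1) \<otimes>\<^sub>k tildeI (nx+1)))"

definition Dlp :: "real \<Rightarrow> real \<Rightarrow> real \<Rightarrow> nat \<Rightarrow> nat \<Rightarrow> nat \<Rightarrow> real mat" where
  "Dlp dx dy dz nx ny nz = bdiag3
     (dx \<cdot>\<^sub>m 1\<^sub>m (nx*(ny+1)*(nz+1)))
     (dy \<cdot>\<^sub>m 1\<^sub>m ((nx+1)*ny*(nz+1)))
     (dz \<cdot>\<^sub>m 1\<^sub>m ((nx+1)*(ny+1)*nz))"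

(* D_U: diagonal matrix of the potential, U given on 1-based nodes *)
definition DUmat :: "(nat \<Rightarrow> nat \<Rightarrow> nat \<Rightarrow> real) \<Rightarrow> nat \<Rightarrow> nat \<Rightarrow> nat \<Rightarrow> real mat" where
  "DUmat U nx ny nz = mat ((nx+1)*(ny+1)*(nz+1)) ((nx+1)*(ny+1)*(nz+1))
     (\<lambda>(p,q). if p = q then U (p mod (nx+1) + 1) ((p div (nx+1)) mod (ny+1) + 1)
                                  (p div ((nx+1)*(ny+1)) + 1) else 0)"

definition Hmat :: "real \<Rightarrow> real \<Rightarrow> real \<Rightarrow> real \<Rightarrow> real \<Rightarrow> nat \<Rightarrow> nat \<Rightarrow> nat
                    \<Rightarrow> (nat \<Rightarrow> nat \<Rightarrow> nat \<Rightarrow> real) \<Rightarrow> real mat" where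
  "Hmat hbar m dx dy dz nx ny nz U =
     (hbar^2 / (2*m)) \<cdot>\<^sub>m (Dop nx ny nz * DSpp dx dy dz nx ny nz * diag_inv (Dlp dx dy dz nx ny nz)
                           * transpose_mat (Dop nx ny nz))
     + DVpp dx dy dz nx ny nz * DUmat U nx ny nz"

definition dt_CFL :: "real \<Rightarrow> real \<Rightarrow> real \<Rightarrow> real \<Rightarrow> real \<Rightarrow> nat \<Rightarrow> nat \<Rightarrow> nat
                    \<Rightarrow> (nat \<Rightarrow> nat \<Rightarrow> nat \<Rightarrow> real) \<Rightarrow> real" where
  "dt_CFL hbar m dx dy dz nx ny nz U =
     2 / ((2*hbar/m) * (1/dx^2 + 1/dy^2 + 1/dz^2)
          + (MAX (i,j,k) \<in> {1..nx+1} \<times> {1..ny+1} \<times> {1..nz+1}. \<bar>U i j k\<bar>) / hbar)"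

definition dt_CFL_gen :: "real \<Rightarrow> real \<Rightarrow> real \<Rightarrow> real \<Rightarrow> real \<Rightarrow> nat \<Rightarrow> nat \<Rightarrow> nat
                    \<Rightarrow> (nat \<Rightarrow> nat \<Rightarrow> nat \<Rightarrow> real) \<Rightarrow> real" where
  "dt_CFL_gen hbar m dx dy dz nx ny nz U =
     (let S = diag_inv_sqrt (DVpp dx dy dz nx ny nz)
      in 2 / spectral_radius (map_mat complex_of_real
                ((1/hbar) \<cdot>\<^sub>m (S * Hmat hbar m dx dy dz nx ny nz U * S))))"

end

theory Submission
  imports Defs
begin

text \<open>
  The matrix \<open>(D_V'')\<^sup>-\<^sup>1\<^sup>/\<^sup>2 H (D_V'')\<^sup>-\<^sup>1\<^sup>/\<^sup>2\<close> is similar to \<open>(D_V'')\<^sup>-\<^sup>1 H\<close>,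
  so its spectral radius is at most the largest absolute row sum of the latter. Each column of \<open>D\<close>
  has one entry \<open>1\<close> and one entry \<open>-1\<close>, and the halved weights at the boundary nodes exactly
  compensate the missing neighbours, so all absolute row sums of the
  kinetic part have the same bound: \<open>hbar\<^sup>2 / (2 m)\<close> times \<open>4 (1/dx\<^sup>2 + 1/dy\<^sup>2 + 1/dz\<^sup>2)\<close>.

  Since \<open>2 / 0 = 0\<close>, the spectral radius must also be shown to be nonzero. The matrix is symmetric, so
  it would otherwise vanish; but the rows of the kinetic part sum to zero and have positive
  diagonal entries, so it has nonzero off-diagonal entries, which the potential cannot cancel.
\<close>

section \<open>Spectral radius estimates\<close>

text \<open>Conjugation by the diagonal matrix of \<open>s\<close> reduces this to the bound of
  eigenvalues by the largest absolute row sum. In the row \<open>p\<close> where the ratio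
  \<open>w\<close> of eigenvector entry to weight is maximal, every \<open>w q\<close> may be
  replaced by \<open>w p\<close>.\<close>

lemma eigenvalue_norm_le_weighted_row_sum:
  fixes M :: "complex mat" and s :: "nat \<Rightarrow> real"
  assumes M: "M \<in> carrier_mat n n" and ev: "eigenvalue M l"
    and s: "\<And>p. p < n \<Longrightarrow> s p > 0"
    and rows: "\<And>p. p < n \<Longrightarrow> (\<Sum>q<n. cmod (M $$ (p,q)) * s q) \<le> r * s p"
  shows "cmod l \<le> r"
proof -
  from ev obtain v where v: "v \<in> carrier_vec n" "v \<noteq> 0\<^sub>v n" "M *\<^sub>v v = l \<cdot>\<^sub>v v"
    using M unfolding eigenvalue_def eigenvector_def by auto
  define w where "w q = cmod (v $ q) / s q" for q
  obtain q0 where q0: "q0 < n" "v $ q0 \<noteq> 0"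
    using v(1,2) by (metis carrier_vecD eq_vecI index_zero_vec(1) index_zero_vec(2))
  then have ne: "{..<n} \<noteq> {}" by auto
  obtain p where p: "p < n" and pmax: "\<And>q. q < n \<Longrightarrow> w q \<le> w p"
  proof -
    have "Max (w ` {..<n}) \<in> w ` {..<n}" using ne by (intro Max_in) auto
    then obtain p where "p < n" "w p = Max (w ` {..<n})" by auto
    then show ?thesis by (intro that[of p]) auto
  qed
  \<comment> \<open>The maximal ratio is positive because an eigenvector has a nonzero entry; hence
    \<open>w p * s p\<close> can be cancelled at the end.\<close>
  have "0 < w q0" using q0 s by (simp add: w_def)
  then have wp: "w p > 0" using pmax[OF q0(1)] by simp
  have vq: "cmod (v $ q) = w q * s q" if "q < n" for q using s[OF that] by (simp add: w_def)
  have "l * v $ p = (M *\<^sub>v v) $ p" using v p by simp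
  also have "\<dots> = (\<Sum>q<n. M $$ (p,q) * v $ q)"
    using M v(1) p by (simp add: scalar_prod_def atLeast0LessThan)
  finally have "cmod l * (w p * s p) = cmod (\<Sum>q<n. M $$ (p,q) * v $ q)"
    by (metis norm_mult vq[OF p])
  also have "\<dots> \<le> (\<Sum>q<n. cmod (M $$ (p,q)) * (w q * s q))"
    by (intro order_trans[OF norm_sum] sum_mono) (simp add: norm_mult vq)
  also have "\<dots> \<le> (\<Sum>q<n. cmod (M $$ (p,q)) * (w p * s q))"
    by (intro sum_mono mult_left_mono mult_right_mono) (auto simp: pmax less_imp_le[OF s])
  also have "\<dots> = w p * (\<Sum>q<n. cmod (M $$ (p,q)) * s q)"
    by (simp add: sum_distrib_left mult_ac)
  also have "\<dots> \<le> w p * (r * s p)" using rows[OF p] wp by simp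
  finally have "cmod l * (w p * s p) \<le> r * (w p * s p)" by (simp add: mult_ac)
  then show ?thesis using wp s[OF p] by simp
qed

lemma pow_mat_add:
  fixes B :: "'a :: semiring_1 mat"
  assumes B: "B \<in> carrier_mat n n"
  shows "B ^\<^sub>m (j + k) = B ^\<^sub>m j * B ^\<^sub>m k"
proof (induction k)
  case (Suc k)
  then show ?case using B by (simp add: assoc_mult_mat[of _ n n _ n _ n])
qed (use B in auto)

text \<open>Powers of a symmetric matrix are symmetric, so a diagonal entry of \<open>C * C\<close>
  is the sum of squares of a row of \<open>C\<close> and dominates the square of the diagonal entry
  of \<open>C\<close>. The exponents start at 2 because the diagonal of \<open>B\<close> itself may
  vanish.\<close>

lemma pow_mat_diag_ge_of_symmetric:
  fixes B :: "real mat"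
  assumes B: "B \<in> carrier_mat n n" and sym: "transpose_mat B = B"
    and i: "i < n" and ge: "(B * B) $$ (i,i) \<ge> 2"
  shows "(B ^\<^sub>m (2 ^ Suc k)) $$ (i,i) \<ge> 2 ^ Suc k"
proof (induction k)
  case 0
  then show ?case using ge B by (simp add: numeral_2_eq_2)
next
  case (Suc k)
  define C where "C = B ^\<^sub>m (2 ^ Suc k)"
  have C: "C \<in> carrier_mat n n" using B by (simp add: C_def)
  have symC: "transpose_mat (B ^\<^sub>m j) = B ^\<^sub>m j" for j
  proof (induction j)
    case (Suc j)
    \<comment> \<open>Transposition reverses the product, and \<open>B\<close> commutes with its own
      powers.\<close>
    have "transpose_mat (B ^\<^sub>m Suc j) = B * B ^\<^sub>m j"
      using Suc B by (simp add: transpose_mult[of _ n n _ n] sym)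
    also have "\<dots> = B ^\<^sub>m Suc j" using pow_mat_add[OF B, of 1 j] B by simp
    finally show ?case .
  qed (use B in auto)
  have "B ^\<^sub>m (2 ^ Suc (Suc k)) = C * C"
    using pow_mat_add[OF B, of "2 ^ Suc k" "2 ^ Suc k"] by (simp add: C_def mult_2)
  moreover have "(C * C) $$ (i,i) = (\<Sum>j<n. C $$ (i,j) * C $$ (i,j))"
  proof -
    have "C $$ (j,i) = C $$ (i,j)" if "j < n" for j
      using symC[of "2 ^ Suc k"] C i that by (metis C_def carrier_matD index_transpose_mat(1))
    then show ?thesis using C i by (simp add: scalar_prod_def atLeast0LessThan)
  qed
  moreover have "C $$ (i,i) * C $$ (i,i) \<le> (\<Sum>j<n. C $$ (i,j) * C $$ (i,j))"
    using i by (intro member_le_sum) auto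
  moreover have "(2::real) * 2 ^ Suc k \<le> C $$ (i,i) * C $$ (i,i)"
  proof (rule mult_mono)
    show "2 ^ Suc k \<le> C $$ (i,i)" using Suc by (simp add: C_def)
    moreover have "(2::real) \<le> 2 ^ Suc k" by simp
    ultimately show "2 \<le> C $$ (i,i)" "0 \<le> C $$ (i,i)" by linarith+
  qed auto
  ultimately show ?case by simp
qed

text \<open>
  If the spectral radius were zero, the powers of every multiple of \<open>A\<close> would be bounded, while
  the diagonal entries of \<open>B, B\<^sup>2, B\<^sup>4, \<dots>\<close> are squared at least in each step.
\<close>
lemma spectral_radius_pos_of_symmetric:
  fixes A :: "real mat"
  assumes A: "A \<in> carrier_mat n n" and sym: "transpose_mat A = A" and nz: "A \<noteq> 0\<^sub>m n n"
  shows "spectral_radius (map_mat complex_of_real A) > 0"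
proof (rule ccontr)
  let ?c = "map_mat complex_of_real"
  assume neg: "\<not> spectral_radius (?c A) > 0"
  obtain i j where ij: "i < n" "j < n" "A $$ (i,j) \<noteq> 0"
    using A nz by (metis carrier_matD eq_matI index_zero_mat)
  have cA: "?c A \<in> carrier_mat n n" using A by simp
  have n: "n > 0" using ij by simp
  have ev0: "l = 0" if "eigenvalue (?c A) l" for l
  proof -
    have "cmod l \<le> spectral_radius (?c A)"
      using spectral_radius_mem_max(2)[OF cA n] that by (auto simp: spectrum_def)
    then have "cmod l \<le> 0" using neg by linarith
    then show ?thesis by simp
  qed
  \<comment> \<open>The scaling makes the chosen entry of \<open>B\<close> have absolute value 2.
    Its square 4 is one of the summands of the diagonal entry of \<open>B * B\<close>, which
    therefore exceeds the required 2.\<close>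
  define t where "t = 2 / \<bar>A $$ (i,j)\<bar>"
  define B where "B = t \<cdot>\<^sub>m A"
  have t: "t \<noteq> 0" using ij by (simp add: t_def)
  have B: "B \<in> carrier_mat n n" using A by (simp add: B_def)
  have cB: "?c B \<in> carrier_mat n n" using B by simp
  have cBA: "?c B = of_real t \<cdot>\<^sub>m ?c A" by (auto simp: B_def)
  have evB: "l = 0" if ev: "eigenvalue (?c B) l" for l
  proof -
    from ev obtain v where v: "v \<in> carrier_vec n" "v \<noteq> 0\<^sub>v n" "?c B *\<^sub>v v = l \<cdot>\<^sub>v v"
      using cB unfolding eigenvalue_def eigenvector_def by auto
    have "?c A *\<^sub>v v = (l / of_real t) \<cdot>\<^sub>v v"
    proof (rule eq_vecI)
      fix k assume "k < dim_vec ((l / of_real t) \<cdot>\<^sub>v v)"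
      then have k: "k < n" using v by simp
      have "of_real t * ((?c A *\<^sub>v v) $ k) = (?c B *\<^sub>v v) $ k"
        using k A v(1) by (simp add: cBA scalar_prod_def sum_distrib_left mult_ac)
      also have "\<dots> = l * v $ k" using v k by simp
      finally show "(?c A *\<^sub>v v) $ k = ((l / of_real t) \<cdot>\<^sub>v v) $ k"
        using k v(1) t by (simp add: field_simps)
    qed (use A v(1) in auto)
    then have "eigenvalue (?c A) (l / of_real t)"
      using v cA unfolding eigenvalue_def eigenvector_def by auto
    from ev0[OF this] t show ?thesis by simp
  qed
  \<comment> \<open>Zero is the only eigenvalue, so the spectral radius is strictly below 1, and a
    single constant then bounds the entries of all powers of \<open>B\<close>.\<close>
  have "spectral_radius (?c B) < 1"
    using spectral_radius_mem_max(1)[OF cB n] by (auto simp: spectrum_def dest: evB)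
  from spectral_radius_jnf_norm_bound_less_1_upper_triangular[OF cB this]
  obtain b where b: "norm_bound (?c B ^\<^sub>m k) b" for k by auto
  have bound: "\<bar>(B ^\<^sub>m k) $$ (i,i)\<bar> \<le> b" for k
  proof -
    have "?c B ^\<^sub>m k = ?c (B ^\<^sub>m k)" by (rule of_real_hom.mat_hom_pow[OF B, symmetric])
    then show ?thesis using b[of k] ij B unfolding norm_bound_def by simp
  qed
  have "A $$ (q,p) = A $$ (p,q)" if "p < n" "q < n" for p q
    using sym A that by (metis carrier_matD index_transpose_mat(1))
  then have symB': "B $$ (q,p) = B $$ (p,q)" if "p < n" "q < n" for p q
    using A that by (simp add: B_def)
  have symB: "transpose_mat B = B" using B symB' by (intro eq_matI) auto
  have "(B * B) $$ (i,i) = (\<Sum>k<n. B $$ (i,k) * B $$ (i,k))"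
    using B ij symB' by (simp add: scalar_prod_def atLeast0LessThan)
  moreover have "B $$ (i,j) * B $$ (i,j) \<le> (\<Sum>k<n. B $$ (i,k) * B $$ (i,k))"
    using ij by (intro member_le_sum[of j "{..<n}" "\<lambda>k. B $$ (i,k) * B $$ (i,k)"]) auto
  moreover have "B $$ (i,j) * B $$ (i,j) = 4"
    using ij A by (simp add: B_def t_def field_simps)
  ultimately have "(B * B) $$ (i,i) \<ge> 2" by simp
  from pow_mat_diag_ge_of_symmetric[OF B symB ij(1) this]
  have le: "2 ^ Suc k \<le> b" for k using bound[of "2 ^ Suc k"] by (meson abs_ge_self order_trans)
  obtain k where "b < 2 ^ k" using real_arch_pow[of 2 b] by auto
  moreover have "(2::real) ^ k \<le> 2 ^ Suc k" by simp
  ultimately show False using le[of k] by linarith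
qed

section \<open>Kronecker products\<close>

lemma div_mod_less_of_less_mult:
  fixes i a b :: nat
  assumes "i < a * b"
  shows "i div b < a" "i mod b < b"
  using assms by (cases "b = 0"; simp add: less_mult_imp_div_less)+

text \<open>Quotient and remainder identify \<open>{..<a*b}\<close> with a product of two index
  ranges; all sums over Kronecker indices factor through this bijection.\<close>

lemma sum_div_mod:
  fixes f g :: "nat \<Rightarrow> 'a :: comm_semiring_1"
  shows "(\<Sum>k<a*b. f (k div b) * g (k mod b)) = (\<Sum>k<a. f k) * (\<Sum>k<b. g k)"
proof -
  have "(\<Sum>k<a*b. f (k div b) * g (k mod b)) = (\<Sum>(k,l)\<in>{..<a} \<times> {..<b}. f k * g l)"
  proof (rule sum.reindex_bij_witness[of _ "\<lambda>(k,l). k * b + l" "\<lambda>k. (k div b, k mod b)"])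
    fix p assume "p \<in> {..<a} \<times> {..<b}"
    then obtain k l where p: "p = (k,l)" "k < a" "l < b" by auto
    have "k * b + l < Suc k * b" using p by simp
    also have "\<dots> \<le> a * b" using p by (intro mult_le_mono1) simp
    finally show "(case p of (k,l) \<Rightarrow> k * b + l) \<in> {..<a*b}" using p by simp
  qed (auto simp: div_mod_less_of_less_mult)
  then show ?thesis by (simp add: sum_product sum.cartesian_product)
qed

lemma kron_dim [simp]:
  "dim_row (A \<otimes>\<^sub>k B) = dim_row A * dim_row B" "dim_col (A \<otimes>\<^sub>k B) = dim_col A * dim_col B"
  by (simp_all add: kron_def)

lemma kron_index:
  assumes "i < dim_row A * dim_row B" "j < dim_col A * dim_col B"
  shows "(A \<otimes>\<^sub>k B) $$ (i,j)
    = A $$ (i div dim_row B, j div dim_col B) * B $$ (i mod dim_row B, j mod dim_col B)"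
  using assms by (simp add: kron_def)

text \<open>The weights are themselves diagonal entries of a Kronecker product with matching sizes,
  so both entry and weight split along quotient and remainder. It serves for a block of
  \<open>D\<close> weighted by the matching block of \<open>D_S''\<close>.\<close>

lemma kron_abs_row_sum:
  fixes A B C E :: "real mat"
  assumes "i < dim_row A * dim_row B"
    and "C \<in> carrier_mat (dim_col A) (dim_col A)" "E \<in> carrier_mat (dim_col B) (dim_col B)"
  shows "(\<Sum>e<dim_col A * dim_col B. \<bar>(A \<otimes>\<^sub>k B) $$ (i,e)\<bar> * (C \<otimes>\<^sub>k E) $$ (e,e))
    = (\<Sum>e<dim_col A. \<bar>A $$ (i div dim_row B, e)\<bar> * C $$ (e,e))
    * (\<Sum>e<dim_col B. \<bar>B $$ (i mod dim_row B, e)\<bar> * E $$ (e,e))"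
proof -
  have "(\<Sum>e<dim_col A * dim_col B. \<bar>(A \<otimes>\<^sub>k B) $$ (i,e)\<bar> * (C \<otimes>\<^sub>k E) $$ (e,e))
    = (\<Sum>e<dim_col A * dim_col B.
        (\<bar>A $$ (i div dim_row B, e div dim_col B)\<bar> * C $$ (e div dim_col B, e div dim_col B))
      * (\<bar>B $$ (i mod dim_row B, e mod dim_col B)\<bar> * E $$ (e mod dim_col B, e mod dim_col B)))"
    using assms by (intro sum.cong refl) (simp add: kron_index abs_mult mult_ac)
  then show ?thesis
    by (simp only: sum_div_mod[where f = "\<lambda>e. \<bar>A $$ (i div dim_row B, e)\<bar> * C $$ (e,e)"
        and g = "\<lambda>e. \<bar>B $$ (i mod dim_row B, e)\<bar> * E $$ (e,e)"])
qed

lemma kron_col_sum: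
  fixes f :: "real \<Rightarrow> real"
  assumes "e < dim_col A * dim_col B" and f: "\<And>x y. f (x * y) = f x * f y"
  shows "(\<Sum>p<dim_row A * dim_row B. f ((A \<otimes>\<^sub>k B) $$ (p,e)))
    = (\<Sum>p<dim_row A. f (A $$ (p, e div dim_col B))) * (\<Sum>p<dim_row B. f (B $$ (p, e mod dim_col B)))"
proof -
  have "(\<Sum>p<dim_row A * dim_row B. f ((A \<otimes>\<^sub>k B) $$ (p,e)))
    = (\<Sum>p<dim_row A * dim_row B.
        f (A $$ (p div dim_row B, e div dim_col B)) * f (B $$ (p mod dim_row B, e mod dim_col B)))"
    using assms(1) by (intro sum.cong refl) (simp add: kron_index f)
  then show ?thesis
    by (simp only: sum_div_mod[where f = "\<lambda>p. f (A $$ (p, e div dim_col B))"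
        and g = "\<lambda>p. f (B $$ (p, e mod dim_col B))"])
qed

text \<open>The product is nested to the left: the remainder of \<open>e\<close> modulo
  \<open>cc\<close> indexes \<open>C\<close>, and the quotient is split once more for
  \<open>A\<close> and \<open>B\<close>.\<close>

lemma kron3_col_sum:
  fixes f :: "real \<Rightarrow> real"
  assumes f: "\<And>x y. f (x * y) = f x * f y"
    and A: "A \<in> carrier_mat ra ca" and B: "B \<in> carrier_mat rb cb" and C: "C \<in> carrier_mat rc cc"
    and e: "e < ca * cb * cc"
  shows "(\<Sum>p<ra * rb * rc. f ((A \<otimes>\<^sub>k B \<otimes>\<^sub>k C) $$ (p,e)))
    = (\<Sum>p<ra. f (A $$ (p, e div cc div cb))) * (\<Sum>p<rb. f (B $$ (p, e div cc mod cb)))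
    * (\<Sum>p<rc. f (C $$ (p, e mod cc)))"
  using kron_col_sum[of e "A \<otimes>\<^sub>k B" C f, OF _ f] kron_col_sum[of "e div cc" A B f, OF _ f]
    A B C e div_mod_less_of_less_mult[OF e] by simp

lemma smult_diagonal:
  fixes A :: "'a :: mult_zero mat"
  assumes "diagonal_mat A"
  shows "diagonal_mat (c \<cdot>\<^sub>m A)"
  using assms by (auto simp: diagonal_mat_def)

lemma kron_diagonal:
  fixes A B :: "'a :: mult_zero mat"
  assumes "diagonal_mat A" "diagonal_mat B" "square_mat A" "square_mat B"
  shows "diagonal_mat (A \<otimes>\<^sub>k B)"
  unfolding diagonal_mat_def
proof (intro allI impI)
  fix i j assume ij: "i < dim_row (A \<otimes>\<^sub>k B)" "j < dim_col (A \<otimes>\<^sub>k B)" "i \<noteq> j"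
  have "i div dim_row B \<noteq> j div dim_row B \<or> i mod dim_row B \<noteq> j mod dim_row B"
    using ij(3) by (metis div_mult_mod_eq)
  moreover have "i div dim_row B < dim_row A" "i mod dim_row B < dim_row B"
      "j div dim_row B < dim_row A" "j mod dim_row B < dim_row B"
    using ij assms(3,4) by (auto intro: div_mod_less_of_less_mult)
  ultimately show "(A \<otimes>\<^sub>k B) $$ (i,j) = 0"
    using ij assms by (auto simp: kron_index diagonal_mat_def)
qed

lemma kron_diag_pos:
  fixes A B :: "real mat"
  assumes "\<And>i. i < dim_row A \<Longrightarrow> A $$ (i,i) > 0" "\<And>i. i < dim_row B \<Longrightarrow> B $$ (i,i) > 0"
    and "square_mat A" "square_mat B" and i: "i < dim_row A * dim_row B"
  shows "(A \<otimes>\<^sub>k B) $$ (i,i) > 0"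
  using assms div_mod_less_of_less_mult[OF i] by (simp add: kron_index)

section \<open>The discretised operators\<close>

lemma sum_lessThan_add:
  fixes f :: "nat \<Rightarrow> 'a :: comm_monoid_add"
  shows "(\<Sum>e<a+b. f e) = (\<Sum>e<a. f e) + (\<Sum>e<b. f (a + e))"
  by (induction b) (simp_all add: add.assoc)

lemma tildeI_dim [simp]: "dim_row (tildeI p) = p" "dim_col (tildeI p) = p"
  by (simp_all add: tildeI_def)

lemma Wmat_dim [simp]: "dim_row (Wmat p) = p" "dim_col (Wmat p) = p + 1"
  by (simp_all add: Wmat_def)

lemma diagonal_tildeI: "diagonal_mat (tildeI p)"
  by (simp add: diagonal_mat_def tildeI_def)

lemma tildeI_pos: "i < p \<Longrightarrow> tildeI p $$ (i,i) > 0"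
  by (simp add: tildeI_def)

lemma diagonal_one: "diagonal_mat (1\<^sub>m p)"
  by (simp add: diagonal_mat_def)

lemma one_abs_row_sum:
  fixes C :: "real mat"
  assumes "i < p"
  shows "(\<Sum>e<p. \<bar>1\<^sub>m p $$ (i,e)\<bar> * C $$ (e,e)) = C $$ (i,i)"
proof -
  have "(\<Sum>e<p. \<bar>1\<^sub>m p $$ (i,e)\<bar> * C $$ (e,e)) = (\<Sum>e<p. if e = i then C $$ (e,e) else 0)"
    using assms by (intro sum.cong refl) auto
  then show ?thesis using assms by simp
qed

lemma one_col_sum:
  assumes "e < p" "f 0 = (0::real)" "f 1 = (1::real)"
  shows "(\<Sum>i<p. f (1\<^sub>m p $$ (i,e) :: real)) = 1"
proof -
  have "(\<Sum>i<p. f (1\<^sub>m p $$ (i,e))) = (\<Sum>i<p. if i = e then 1 else 0)"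
    using assms by (intro sum.cong refl) auto
  then show ?thesis using assms by simp
qed

text \<open>Node \<open>i\<close> of a line of \<open>p\<close> edges meets the edges
  \<open>i - 1\<close> and \<open>i\<close> as far as they exist: two in the interior, one at either
  end. The factor \<open>1\<^sub>m p $$ (e,e)\<close> equals 1 and gives the sum the shape of
  \<open>kron_abs_row_sum\<close>.\<close>

lemma Wmat_abs_row_sum:
  assumes "i < p + 1" "p \<ge> 1"
  shows "(\<Sum>e<p. \<bar>transpose_mat (Wmat p) $$ (i,e)\<bar> * 1\<^sub>m p $$ (e,e)) = 2 * tildeI (p + 1) $$ (i,i)"
proof -
  have "(\<Sum>e<p. \<bar>transpose_mat (Wmat p) $$ (i,e)\<bar> * 1\<^sub>m p $$ (e,e))
      = (\<Sum>e<p. (if e = i then 1 else 0) + (if i \<noteq> 0 \<and> e = i - 1 then 1 else (0::real)))"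
    using assms by (intro sum.cong refl) (auto simp: Wmat_def)
  also have "\<dots> = (if i < p then 1 else 0) + (if i \<noteq> 0 then 1 else 0)"
    using assms by (cases "i = 0") (auto simp: sum.distrib)
  finally show ?thesis using assms by (auto simp: tildeI_def)
qed

text \<open>Edge \<open>e\<close> runs from node \<open>e\<close>, with entry -1, to node
  \<open>e + 1\<close>, with entry 1.\<close>

lemma Wmat_col_sum:
  assumes "e < p" "f 0 = (0::real)"
  shows "(\<Sum>i<p + 1. f (transpose_mat (Wmat p) $$ (i,e))) = f 1 + f (- 1)"
proof -
  have "(\<Sum>i<p + 1. f (transpose_mat (Wmat p) $$ (i,e)))
      = (\<Sum>i<p + 1. (if i = e + 1 then f 1 else 0) + (if i = e then f (- 1) else (0::real)))"
    using assms by (intro sum.cong refl) (auto simp: Wmat_def)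
  then show ?thesis using assms by (simp add: sum.distrib del: sum.lessThan_Suc)
qed

text \<open>Multiplying by a diagonal matrix on the right scales columns. With \<open>A\<close> the
  node-edge incidence matrix this writes the kinetic matrix as a sum over edges.\<close>

lemma mult_diagonal_transpose_index:
  fixes A S T :: "real mat"
  assumes A: "A \<in> carrier_mat n k" and S: "S \<in> carrier_mat k k" and T: "T \<in> carrier_mat k k"
    and dS: "diagonal_mat S" and dT: "diagonal_mat T" and pq: "p < n" "q < n"
  shows "(A * S * T * transpose_mat A) $$ (p,q)
    = (\<Sum>e<k. A $$ (p,e) * (S $$ (e,e) * T $$ (e,e)) * A $$ (q,e))"
proof -
  have right: "(B * R) $$ (p,e) = B $$ (p,e) * R $$ (e,e)"
    if B: "B \<in> carrier_mat n k" and R: "R \<in> carrier_mat k k" "diagonal_mat R" and e: "e < k"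
    for B R :: "real mat" and e
  proof -
    have "(B * R) $$ (p,e) = (\<Sum>l<k. B $$ (p,l) * R $$ (l,e))"
      using B R e pq by (simp add: scalar_prod_def atLeast0LessThan)
    also have "\<dots> = (\<Sum>l<k. if l = e then B $$ (p,l) * R $$ (l,e) else 0)"
      using R e by (intro sum.cong refl) (auto simp: diagonal_mat_def)
    finally show ?thesis using e by simp
  qed
  have AS: "A * S \<in> carrier_mat n k" using A S by simp
  have "(A * S * T * transpose_mat A) $$ (p,q) = (\<Sum>e<k. (A * S * T) $$ (p,e) * A $$ (q,e))"
    using A S T pq by (simp add: scalar_prod_def atLeast0LessThan)
  also have "\<dots> = (\<Sum>e<k. A $$ (p,e) * (S $$ (e,e) * T $$ (e,e)) * A $$ (q,e))"
    by (intro sum.cong refl) (simp add: right[OF AS T dT] right[OF A S dS] mult_ac)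
  finally show ?thesis .
qed

lemma bdiag3_dim [simp]:
  "dim_row (bdiag3 A B C) = dim_row A + dim_row B + dim_row C"
  "dim_col (bdiag3 A B C) = dim_col A + dim_col B + dim_col C"
  by (simp_all add: bdiag3_def)

lemma bdiag3_diagonal:
  assumes "diagonal_mat A" "diagonal_mat B" "diagonal_mat C" "square_mat A" "square_mat B" "square_mat C"
  shows "diagonal_mat (bdiag3 A B C)"
  using assms by (auto simp: bdiag3_def diagonal_mat_def)

lemma bdiag3_index:
  assumes "square_mat A" "square_mat B" "square_mat C"
  shows "e < dim_row A \<Longrightarrow> bdiag3 A B C $$ (e,e) = A $$ (e,e)"
    and "e < dim_row B \<Longrightarrow> bdiag3 A B C $$ (dim_row A + e, dim_row A + e) = B $$ (e,e)"
    and "e < dim_row C \<Longrightarrow>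
      bdiag3 A B C $$ (dim_row A + dim_row B + e, dim_row A + dim_row B + e) = C $$ (e,e)"
  using assms by (auto simp: bdiag3_def)

text \<open>
  Rows of \<open>Dop\<close> are nodes, columns are edges, grouped by direction.
  The diagonal matrix \<open>D_S'' (D_l')\<^sup>-\<^sup>1\<close> is encoded by the function \<open>weight\<close> on the edges, so that
  \<open>K\<close> below is \<open>D D_S'' (D_l')\<^sup>-\<^sup>1 D\<^sup>T\<close>.
\<close>
locale box_grid =
  fixes dx dy dz :: real and nx ny nz :: nat
  assumes cell_pos: "dx > 0" "dy > 0" "dz > 0"
    and cells: "nx \<ge> 1" "ny \<ge> 1" "nz \<ge> 1"
begin

text \<open>The factors follow the order of the Kronecker factors, x being the fastest coordinate,
  so \<open>div\<close> and \<open>mod\<close> split off x first.\<close>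

definition nodes :: nat where "nodes = (nz+1) * (ny+1) * (nx+1)"
definition x_edges :: nat where "x_edges = (nz+1) * (ny+1) * nx"
definition y_edges :: nat where "y_edges = (nz+1) * ny * (nx+1)"
definition z_edges :: nat where "z_edges = nz * (ny+1) * (nx+1)"
definition edges :: nat where "edges = x_edges + y_edges + z_edges"

text \<open>The blocks are pure Kronecker products, without the minus sign they carry in
  \<open>Dop\<close>; \<open>G_eq\<close> restores it.\<close>

definition "Dx = (1\<^sub>m (nz+1) \<otimes>\<^sub>k 1\<^sub>m (ny+1) \<otimes>\<^sub>k transpose_mat (Wmat nx) :: real mat)"
definition "Dy = (1\<^sub>m (nz+1) \<otimes>\<^sub>k transpose_mat (Wmat ny) \<otimes>\<^sub>k 1\<^sub>m (nx+1) :: real mat)"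
definition "Dz = (transpose_mat (Wmat nz) \<otimes>\<^sub>k 1\<^sub>m (ny+1) \<otimes>\<^sub>k 1\<^sub>m (nx+1) :: real mat)"

definition "Sx = (tildeI (nz+1) \<otimes>\<^sub>k tildeI (ny+1) \<otimes>\<^sub>k 1\<^sub>m nx)"
definition "Sy = (tildeI (nz+1) \<otimes>\<^sub>k 1\<^sub>m ny \<otimes>\<^sub>k tildeI (nx+1))"
definition "Sz = (1\<^sub>m nz \<otimes>\<^sub>k tildeI (ny+1) \<otimes>\<^sub>k tildeI (nx+1))"

abbreviation "G \<equiv> Dop nx ny nz"
abbreviation "S \<equiv> DSpp dx dy dz nx ny nz"
abbreviation "L \<equiv> Dlp dx dy dz nx ny nz"
abbreviation "V \<equiv> DVpp dx dy dz nx ny nz"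

definition weight :: "nat \<Rightarrow> real" where "weight e = S $$ (e,e) * diag_inv L $$ (e,e)"

lemmas edge_defs = x_edges_def y_edges_def z_edges_def

lemma D_dims [simp]:
  "dim_row Dx = nodes" "dim_col Dx = x_edges"
  "dim_row Dy = nodes" "dim_col Dy = y_edges"
  "dim_row Dz = nodes" "dim_col Dz = z_edges"
  by (simp_all add: Dx_def Dy_def Dz_def nodes_def edge_defs)

lemma S_dims [simp]:
  "dim_row Sx = x_edges" "dim_col Sx = x_edges"
  "dim_row Sy = y_edges" "dim_col Sy = y_edges"
  "dim_row Sz = z_edges" "dim_col Sz = z_edges"
  by (simp_all add: Sx_def Sy_def Sz_def edge_defs)

lemma G_eq: "G = hcat3 (- Dx) (- Dy) (- Dz)"
  by (simp add: Dop_def Dx_def Dy_def Dz_def)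

lemma S_eq: "S = bdiag3 ((dy*dz) \<cdot>\<^sub>m Sx) ((dx*dz) \<cdot>\<^sub>m Sy) ((dx*dy) \<cdot>\<^sub>m Sz)"
  by (simp add: DSpp_def Sx_def Sy_def Sz_def)

lemma L_eq: "L = bdiag3 (dx \<cdot>\<^sub>m 1\<^sub>m x_edges) (dy \<cdot>\<^sub>m 1\<^sub>m y_edges) (dz \<cdot>\<^sub>m 1\<^sub>m z_edges)"
proof -
  have "nx * (ny+1) * (nz+1) = x_edges" "(nx+1) * ny * (nz+1) = y_edges" "(nx+1) * (ny+1) * nz = z_edges"
    by (simp_all only: edge_defs mult_ac)
  then show ?thesis by (simp only: Dlp_def)
qed

lemma carriers:
  "G \<in> carrier_mat nodes edges" "S \<in> carrier_mat edges edges"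
  "diag_inv L \<in> carrier_mat edges edges" "V \<in> carrier_mat nodes nodes"
  by (auto simp: G_eq S_eq L_eq hcat3_def diag_inv_def edges_def DVpp_def nodes_def intro!: carrier_matI)

lemma G_index:
  assumes "p < nodes"
  shows "e < x_edges \<Longrightarrow> G $$ (p, e) = - Dx $$ (p,e)"
    and "e < y_edges \<Longrightarrow> G $$ (p, x_edges + e) = - Dy $$ (p,e)"
    and "e < z_edges \<Longrightarrow> G $$ (p, x_edges + y_edges + e) = - Dz $$ (p,e)"
  using assms by (auto simp: G_eq hcat3_def)

lemma diagonal_S: "diagonal_mat S"
  unfolding S_eq
  by (intro bdiag3_diagonal smult_diagonal)
    (auto simp: Sx_def Sy_def Sz_def intro!: kron_diagonal diagonal_tildeI diagonal_one)

lemma diagonal_diag_inv: "diagonal_mat (diag_inv L)"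
  by (simp add: diagonal_mat_def diag_inv_def)

lemma diagonal_V: "diagonal_mat V"
  unfolding DVpp_def by (intro smult_diagonal kron_diagonal diagonal_tildeI) auto

text \<open>Each coefficient is the area of a full dual face divided by the length of the edge
  crossing it; the reduction at the boundary stays in \<open>Sx\<close>, \<open>Sy\<close>,
  \<open>Sz\<close>.\<close>

lemma weight_eq:
  "e < x_edges \<Longrightarrow> weight e = dy * dz / dx * Sx $$ (e,e)"
  "e < y_edges \<Longrightarrow> weight (x_edges + e) = dx * dz / dy * Sy $$ (e,e)"
  "e < z_edges \<Longrightarrow> weight (x_edges + y_edges + e) = dx * dy / dz * Sz $$ (e,e)"
proof -
  let ?A = "(dy*dz) \<cdot>\<^sub>m Sx" and ?B = "(dx*dz) \<cdot>\<^sub>m Sy" and ?C = "(dx*dy) \<cdot>\<^sub>m Sz"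
  note iS = bdiag3_index[of ?A ?B ?C, folded S_eq]
  note iL = bdiag3_index[of "dx \<cdot>\<^sub>m 1\<^sub>m x_edges" "dy \<cdot>\<^sub>m 1\<^sub>m y_edges" "dz \<cdot>\<^sub>m 1\<^sub>m z_edges", folded L_eq]
  have dL: "dim_row L = x_edges + y_edges + z_edges" by (simp add: L_eq)
  show "e < x_edges \<Longrightarrow> weight e = dy * dz / dx * Sx $$ (e,e)"
    "e < y_edges \<Longrightarrow> weight (x_edges + e) = dx * dz / dy * Sy $$ (e,e)"
    "e < z_edges \<Longrightarrow> weight (x_edges + y_edges + e) = dx * dy / dz * Sz $$ (e,e)"
    using iS iL by (simp_all add: weight_def diag_inv_def dL)
qed

lemma S_parts_pos:
  "e < x_edges \<Longrightarrow> Sx $$ (e,e) > 0" "e < y_edges \<Longrightarrow> Sy $$ (e,e) > 0" "e < z_edges \<Longrightarrow> Sz $$ (e,e) > 0"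
  by (auto simp: Sx_def Sy_def Sz_def edge_defs intro!: kron_diag_pos tildeI_pos)

lemma edge_cases:
  assumes "e < edges"
  obtains "e < x_edges" | e' where "e = x_edges + e'" "e' < y_edges"
    | e' where "e = x_edges + y_edges + e'" "e' < z_edges"
proof -
  have "e < x_edges \<or> e = x_edges + (e - x_edges) \<and> e - x_edges < y_edges \<or>
    e = x_edges + y_edges + (e - x_edges - y_edges) \<and> e - x_edges - y_edges < z_edges"
    using assms by (auto simp: edges_def)
  then show ?thesis using that by blast
qed

lemma weight_pos: "e < edges \<Longrightarrow> weight e > 0"
  using cell_pos by (elim edge_cases) (simp_all add: weight_eq S_parts_pos)

section \<open>Nodal volumes, row sums and column sums of \<open>D\<close>\<close>

lemma V_index: "p < nodes \<Longrightarrow> V $$ (p,p) = dx * dy * dz *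
    (tildeI (nz+1) $$ (p div (nx+1) div (ny+1), p div (nx+1) div (ny+1)) *
     tildeI (ny+1) $$ (p div (nx+1) mod (ny+1), p div (nx+1) mod (ny+1)) *
     tildeI (nx+1) $$ (p mod (nx+1), p mod (nx+1)))"
  unfolding DVpp_def nodes_def using div_mod_less_of_less_mult[of p "(nz+1)*(ny+1)" "nx+1"]
  by (subst index_smult_mat) (auto simp: kron_index simp del: add_Suc_right)

lemma V_pos:
  assumes "p < nodes"
  shows "V $$ (p,p) > 0"
  using div_mod_less_of_less_mult[OF assms[unfolded nodes_def]]
    div_mod_less_of_less_mult[of "p div (nx+1)" "nz+1" "ny+1"] cell_pos
  by (simp only: V_index[OF assms] mult_pos_pos tildeI_pos)

text \<open>In the direction of the edges the factor \<open>2 * tildeI\<close> comes from counting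
  the edges at a node; in the two other directions \<open>tildeI\<close> comes from the face areas.
  Each direction thus yields the same product, twice the nodal volume measured in full
  cells.\<close>

lemma D_row_sums:
  assumes "p < nodes"
  defines "k \<equiv> dx * dy * dz"
  shows "(\<Sum>e<x_edges. \<bar>Dx $$ (p,e)\<bar> * Sx $$ (e,e)) = 2 * V $$ (p,p) / k"
    and "(\<Sum>e<y_edges. \<bar>Dy $$ (p,e)\<bar> * Sy $$ (e,e)) = 2 * V $$ (p,p) / k"
    and "(\<Sum>e<z_edges. \<bar>Dz $$ (p,e)\<bar> * Sz $$ (e,e)) = 2 * V $$ (p,p) / k"
proof -
  have k: "k \<noteq> 0" using cell_pos by (simp add: k_def)
  have p: "p < (nz+1) * (ny+1) * (nx+1)" using assms(1) by (simp add: nodes_def)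
  \<comment> \<open>The coordinates of the node are its digits: \<open>p1(2)\<close> bounds x,
    \<open>p2(1)\<close> bounds z and \<open>p2(2)\<close> bounds y.\<close>
  note p1 = div_mod_less_of_less_mult[OF p]
  note p2 = div_mod_less_of_less_mult[OF p1(1)]
  note sums = one_abs_row_sum[OF p1(2)] one_abs_row_sum[OF p2(1)] one_abs_row_sum[OF p2(2)]
    Wmat_abs_row_sum[OF p1(2) cells(1)] Wmat_abs_row_sum[OF p2(2) cells(2)]
    Wmat_abs_row_sum[OF p2(1) cells(3)]
  have "(\<Sum>e<x_edges. \<bar>Dx $$ (p,e)\<bar> * Sx $$ (e,e))
      = tildeI (nz+1) $$ (p div (nx+1) div (ny+1), p div (nx+1) div (ny+1)) *
        tildeI (ny+1) $$ (p div (nx+1) mod (ny+1), p div (nx+1) mod (ny+1)) *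
        (2 * tildeI (nx+1) $$ (p mod (nx+1), p mod (nx+1)))"
    using kron_abs_row_sum[of p "1\<^sub>m (nz+1) \<otimes>\<^sub>k 1\<^sub>m (ny+1)" "transpose_mat (Wmat nx)"
        "tildeI (nz+1) \<otimes>\<^sub>k tildeI (ny+1)" "1\<^sub>m nx"]
      kron_abs_row_sum[of "p div (nx+1)" "1\<^sub>m (nz+1)" "1\<^sub>m (ny+1)" "tildeI (nz+1)" "tildeI (ny+1)"]
      p p1(1)
    by (simp add: Dx_def Sx_def x_edges_def sums[simplified] carrier_matI)
  then show "(\<Sum>e<x_edges. \<bar>Dx $$ (p,e)\<bar> * Sx $$ (e,e)) = 2 * V $$ (p,p) / k"
    using k by (simp add: V_index[OF assms(1)] k_def)
  have "(\<Sum>e<y_edges. \<bar>Dy $$ (p,e)\<bar> * Sy $$ (e,e))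
      = tildeI (nz+1) $$ (p div (nx+1) div (ny+1), p div (nx+1) div (ny+1)) *
        (2 * tildeI (ny+1) $$ (p div (nx+1) mod (ny+1), p div (nx+1) mod (ny+1))) *
        tildeI (nx+1) $$ (p mod (nx+1), p mod (nx+1))"
    using kron_abs_row_sum[of p "1\<^sub>m (nz+1) \<otimes>\<^sub>k transpose_mat (Wmat ny)" "1\<^sub>m (nx+1)"
        "tildeI (nz+1) \<otimes>\<^sub>k 1\<^sub>m ny" "tildeI (nx+1)"]
      kron_abs_row_sum[of "p div (nx+1)" "1\<^sub>m (nz+1)" "transpose_mat (Wmat ny)" "tildeI (nz+1)" "1\<^sub>m ny"]
      p p1(1)
    by (simp add: Dy_def Sy_def y_edges_def sums[simplified] carrier_matI)
  then show "(\<Sum>e<y_edges. \<bar>Dy $$ (p,e)\<bar> * Sy $$ (e,e)) = 2 * V $$ (p,p) / k"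
    using k by (simp add: V_index[OF assms(1)] k_def)
  have "(\<Sum>e<z_edges. \<bar>Dz $$ (p,e)\<bar> * Sz $$ (e,e))
      = 2 * tildeI (nz+1) $$ (p div (nx+1) div (ny+1), p div (nx+1) div (ny+1)) *
        tildeI (ny+1) $$ (p div (nx+1) mod (ny+1), p div (nx+1) mod (ny+1)) *
        tildeI (nx+1) $$ (p mod (nx+1), p mod (nx+1))"
    using kron_abs_row_sum[of p "transpose_mat (Wmat nz) \<otimes>\<^sub>k 1\<^sub>m (ny+1)" "1\<^sub>m (nx+1)"
        "1\<^sub>m nz \<otimes>\<^sub>k tildeI (ny+1)" "tildeI (nx+1)"]
      kron_abs_row_sum[of "p div (nx+1)" "transpose_mat (Wmat nz)" "1\<^sub>m (ny+1)" "1\<^sub>m nz" "tildeI (ny+1)"]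
      p p1(1)
    by (simp add: Dz_def Sz_def z_edges_def sums[simplified] carrier_matI)
  then show "(\<Sum>e<z_edges. \<bar>Dz $$ (p,e)\<bar> * Sz $$ (e,e)) = 2 * V $$ (p,p) / k"
    using k by (simp add: V_index[OF assms(1)] k_def)
qed

lemma G_row_sum:
  assumes p: "p < nodes"
  shows "(\<Sum>e<edges. \<bar>G $$ (p,e)\<bar> * weight e) = 2 * V $$ (p,p) * (1/dx^2 + 1/dy^2 + 1/dz^2)"
proof -
  have "(\<Sum>e<edges. \<bar>G $$ (p,e)\<bar> * weight e)
      = dy*dz/dx * (\<Sum>e<x_edges. \<bar>Dx $$ (p,e)\<bar> * Sx $$ (e,e))
      + dx*dz/dy * (\<Sum>e<y_edges. \<bar>Dy $$ (p,e)\<bar> * Sy $$ (e,e))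
      + dx*dy/dz * (\<Sum>e<z_edges. \<bar>Dz $$ (p,e)\<bar> * Sz $$ (e,e))"
    unfolding edges_def sum_lessThan_add sum_distrib_left
    by (intro arg_cong2[of _ _ _ _ "(+)"] sum.cong refl) (simp_all add: G_index[OF p] weight_eq)
  \<comment> \<open>In the x direction \<open>dy*dz/dx\<close> divided by the cell volume
    \<open>dx*dy*dz\<close> is \<open>1/dx^2\<close>, and likewise for y and z.\<close>
  also have "\<dots> = 2 * V $$ (p,p) * (1/dx^2 + 1/dy^2 + 1/dz^2)"
    unfolding D_row_sums[OF p] using cell_pos by (simp add: field_simps power2_eq_square)
  finally show ?thesis .
qed

text \<open>Stated for multiplicative \<open>f\<close> to cover both the identity and the absolute value.\<close>
lemma G_col_sum:
  fixes f :: "real \<Rightarrow> real"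
  assumes e: "e < edges" and f: "\<And>x y. f (x * y) = f x * f y" "f 0 = 0" "f 1 = 1"
  shows "(\<Sum>p<nodes. f (G $$ (p,e))) = f (- 1) * (1 + f (- 1))"
proof -
  \<comment> \<open>One factor \<open>f (- 1)\<close> comes from the sign of the blocks of
    \<open>G\<close>, the other from the entry -1 of \<open>Wmat\<close>. The total is 0 for the
    identity and 2 for the absolute value.\<close>
  have neg: "f (- x) = f (- 1) * f x" for x using f(1)[of "- 1" x] by simp
  from e show ?thesis
  proof (cases rule: edge_cases)
    case 1
    then have e: "e < (nz+1) * (ny+1) * nx" by (simp add: x_edges_def)
    \<comment> \<open>Columns are edges here: an x-edge has \<open>nx\<close>, not
      \<open>nx + 1\<close>, positions along x, so its last digit is taken to base
      \<open>nx\<close>.\<close>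
    note e1 = div_mod_less_of_less_mult[OF e]
    note e2 = div_mod_less_of_less_mult[OF e1(1)]
    have "(\<Sum>p<nodes. f (G $$ (p,e))) = f (- 1) * (\<Sum>p<nodes. f (Dx $$ (p,e)))"
      using 1 unfolding sum_distrib_left by (intro sum.cong refl) (simp add: G_index neg[of "Dx $$ (_, e)"])
    also have "(\<Sum>p<nodes. f (Dx $$ (p,e))) = 1 + f (- 1)"
    proof -
      have "(1\<^sub>m (nz+1) :: real mat) \<in> carrier_mat (nz+1) (nz+1)"
        "(1\<^sub>m (ny+1) :: real mat) \<in> carrier_mat (ny+1) (ny+1)"
        "transpose_mat (Wmat nx) \<in> carrier_mat (nx+1) nx"
        by (auto intro!: carrier_matI)
      from kron3_col_sum[where f = f, OF f(1) this e] show ?thesis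
        unfolding Dx_def nodes_def
        by (simp only: one_col_sum[of _ _ f, OF e2(1) f(2,3)] one_col_sum[of _ _ f, OF e2(2) f(2,3)]
          Wmat_col_sum[of _ _ f, OF e1(2) f(2)] f(3) mult_1_left mult_1_right)
    qed
    finally show ?thesis .
  next
    case (2 e')
    then have e: "e' < (nz+1) * ny * (nx+1)" by (simp add: y_edges_def)
    note e1 = div_mod_less_of_less_mult[OF e]
    note e2 = div_mod_less_of_less_mult[OF e1(1)]
    have "(\<Sum>p<nodes. f (G $$ (p,e))) = f (- 1) * (\<Sum>p<nodes. f (Dy $$ (p,e')))"
      using 2 unfolding sum_distrib_left by (intro sum.cong refl) (simp add: G_index neg[of "Dy $$ (_, e')"])
    also have "(\<Sum>p<nodes. f (Dy $$ (p,e'))) = 1 + f (- 1)"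
    proof -
      have "(1\<^sub>m (nz+1) :: real mat) \<in> carrier_mat (nz+1) (nz+1)"
        "transpose_mat (Wmat ny) \<in> carrier_mat (ny+1) ny"
        "(1\<^sub>m (nx+1) :: real mat) \<in> carrier_mat (nx+1) (nx+1)"
        by (auto intro!: carrier_matI)
      from kron3_col_sum[where f = f, OF f(1) this e] show ?thesis
        unfolding Dy_def nodes_def
        by (simp only: one_col_sum[of _ _ f, OF e2(1) f(2,3)] one_col_sum[of _ _ f, OF e1(2) f(2,3)]
          Wmat_col_sum[of _ _ f, OF e2(2) f(2)] f(3) mult_1_left mult_1_right)
    qed
    finally show ?thesis .
  next
    case (3 e')
    then have e: "e' < nz * (ny+1) * (nx+1)" by (simp add: z_edges_def)
    note e1 = div_mod_less_of_less_mult[OF e]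
    note e2 = div_mod_less_of_less_mult[OF e1(1)]
    have "(\<Sum>p<nodes. f (G $$ (p,e))) = f (- 1) * (\<Sum>p<nodes. f (Dz $$ (p,e')))"
      using 3 unfolding sum_distrib_left by (intro sum.cong refl) (simp add: G_index neg[of "Dz $$ (_, e')"])
    also have "(\<Sum>p<nodes. f (Dz $$ (p,e'))) = 1 + f (- 1)"
    proof -
      have "transpose_mat (Wmat nz) \<in> carrier_mat (nz+1) nz"
        "(1\<^sub>m (ny+1) :: real mat) \<in> carrier_mat (ny+1) (ny+1)"
        "(1\<^sub>m (nx+1) :: real mat) \<in> carrier_mat (nx+1) (nx+1)"
        by (auto intro!: carrier_matI)
      from kron3_col_sum[where f = f, OF f(1) this e] show ?thesis
        unfolding Dz_def nodes_def
        by (simp only: one_col_sum[of _ _ f, OF e2(2) f(2,3)] one_col_sum[of _ _ f, OF e1(2) f(2,3)]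
          Wmat_col_sum[of _ _ f, OF e2(1) f(2)] f(3) mult_1_left mult_1_right)
    qed
    finally show ?thesis .
  qed
qed

lemma G_col_sum_zero: "e < edges \<Longrightarrow> (\<Sum>p<nodes. G $$ (p,e)) = 0"
  using G_col_sum[of e "\<lambda>x. x"] by simp

lemma G_col_abs_sum: "e < edges \<Longrightarrow> (\<Sum>p<nodes. \<bar>G $$ (p,e)\<bar>) = 2"
  using G_col_sum[of e abs] by (simp add: abs_mult)

section \<open>The kinetic matrix\<close>

definition K :: "nat \<Rightarrow> nat \<Rightarrow> real" where
  "K p q = (\<Sum>e<edges. G $$ (p,e) * weight e * G $$ (q,e))"

lemma K_commute: "K p q = K q p"
  by (simp add: K_def mult_ac)

text \<open>Constant vectors lie in the kernel of the transpose of \<open>G\<close>, since each edge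
  contributes 1 and -1.\<close>

lemma K_row_sum:
  assumes "p < nodes"
  shows "(\<Sum>q<nodes. K p q) = 0"
proof -
  have "(\<Sum>q<nodes. K p q) = (\<Sum>e<edges. G $$ (p,e) * weight e * (\<Sum>q<nodes. G $$ (q,e)))"
    unfolding K_def sum_distrib_left by (rule sum.swap)
  then show ?thesis by (simp add: G_col_sum_zero)
qed

text \<open>After the triangle inequality over edges, the sum over \<open>q\<close> counts the two
  ends of each edge and doubles the bound of \<open>G_row_sum\<close>.\<close>

lemma K_abs_row_sum:
  assumes p: "p < nodes"
  shows "(\<Sum>q<nodes. \<bar>K p q\<bar>) \<le> 4 * V $$ (p,p) * (1/dx^2 + 1/dy^2 + 1/dz^2)"
proof -
  have "(\<Sum>q<nodes. \<bar>K p q\<bar>) \<le> (\<Sum>q<nodes. \<Sum>e<edges. \<bar>G $$ (p,e)\<bar> * weight e * \<bar>G $$ (q,e)\<bar>)"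
    unfolding K_def
    by (intro sum_mono order_trans[OF sum_abs]) (simp add: abs_mult weight_pos less_imp_le)
  also have "\<dots> = (\<Sum>e<edges. \<bar>G $$ (p,e)\<bar> * weight e * (\<Sum>q<nodes. \<bar>G $$ (q,e)\<bar>))"
    unfolding sum_distrib_left by (rule sum.swap)
  also have "\<dots> = 2 * (\<Sum>e<edges. \<bar>G $$ (p,e)\<bar> * weight e)"
    by (simp add: G_col_abs_sum sum_distrib_left mult_ac)
  finally show ?thesis unfolding G_row_sum[OF p] by simp
qed

text \<open>The entry is a sum of squares with positive weights. If it vanished, row
  \<open>p\<close> of \<open>G\<close> would be zero, against the positive value in
  \<open>G_row_sum\<close>.\<close>

lemma K_diag_pos:
  assumes p: "p < nodes"
  shows "K p p > 0"
proof -
  have nn: "0 \<le> G $$ (p,e) * weight e * G $$ (p,e)" if "e < edges" for e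
  proof -
    have "0 \<le> (G $$ (p,e))\<^sup>2 * weight e" using weight_pos[OF that] by simp
    then show ?thesis by (simp add: power2_eq_square mult_ac)
  qed
  have "K p p \<noteq> 0"
  proof
    assume "K p p = 0"
    then have "\<forall>e\<in>{..<edges}. G $$ (p,e) * weight e * G $$ (p,e) = 0"
      unfolding K_def by (subst (asm) sum_nonneg_eq_0_iff) (auto simp: nn)
    then have "(\<Sum>e<edges. \<bar>G $$ (p,e)\<bar> * weight e) = 0"
      by (intro sum.neutral) auto
    moreover have "1/dx^2 + 1/dy^2 + 1/dz^2 > 0" using cell_pos by (simp add: add_pos_pos)
    ultimately show False using G_row_sum[OF p] V_pos[OF p] by simp
  qed
  moreover have "K p p \<ge> 0" unfolding K_def by (intro sum_nonneg) (auto simp: nn)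
  ultimately show ?thesis by simp
qed

end

section \<open>Comparison of the two time steps\<close>

theorem theorem2:
  fixes hbar m dx dy dz :: real and nx ny nz :: nat and U :: "nat \<Rightarrow> nat \<Rightarrow> nat \<Rightarrow> real"
  assumes "hbar > 0" and "m > 0" and "dx > 0" and "dy > 0" and "dz > 0"
    and "nx \<ge> 1" and "ny \<ge> 1" and "nz \<ge> 1"
  shows "dt_CFL hbar m dx dy dz nx ny nz U \<le> dt_CFL_gen hbar m dx dy dz nx ny nz U"
proof -
  interpret box_grid dx dy dz nx ny nz using assms by unfold_locales
  define c where "c = hbar^2 / (2*m)"
  define umax where "umax = (MAX (i,j,k) \<in> {1..nx+1} \<times> {1..ny+1} \<times> {1..nz+1}. \<bar>U i j k\<bar>)"
  define r where "r = (2*hbar/m) * (1/dx^2 + 1/dy^2 + 1/dz^2) + umax / hbar"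
  \<comment> \<open>The digits of \<open>p\<close> are 0-based while \<open>U\<close> is given on
    1-based nodes, hence the shifts by 1.\<close>
  define u where "u p = U (p mod (nx+1) + 1) ((p div (nx+1)) mod (ny+1) + 1)
    (p div ((nx+1)*(ny+1)) + 1)" for p
  define H where "H = Hmat hbar m dx dy dz nx ny nz U"
  define R where "R = diag_inv_sqrt V"
  define M where "M = (1/hbar) \<cdot>\<^sub>m (R * H * R)"
  have c: "c > 0" using assms by (simp add: c_def)

  have u_le: "\<bar>u p\<bar> \<le> umax" if p: "p < nodes" for p
  proof -
    note p1 = div_mod_less_of_less_mult[OF p[unfolded nodes_def]]
    note p2 = div_mod_less_of_less_mult[OF p1(1)]
    have "(p mod (nx+1) + 1, (p div (nx+1)) mod (ny+1) + 1, p div ((nx+1)*(ny+1)) + 1)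
        \<in> {1..nx+1} \<times> {1..ny+1} \<times> {1..nz+1}"
      \<comment> \<open>\<open>div_mult2_eq\<close> turns the division by
        \<open>(nx+1)*(ny+1)\<close> into the iterated division whose digits are bounded by
        \<open>p1\<close> and \<open>p2\<close>.\<close>
      using p1 p2 by (simp add: div_mult2_eq del: mult_Suc mult_Suc_right)
    then have "\<bar>u p\<bar> \<in> (\<lambda>(i,j,k). \<bar>U i j k\<bar>) ` ({1..nx+1} \<times> {1..ny+1} \<times> {1..nz+1})"
      unfolding u_def by (rule rev_image_eqI) simp
    then show ?thesis unfolding umax_def by (intro Max_ge) auto
  qed
  have n: "(nx+1)*(ny+1)*(nz+1) = nodes" by (simp only: nodes_def mult_ac)
  have DU: "DUmat U nx ny nz \<in> carrier_mat nodes nodes"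
    unfolding DUmat_def n by simp
  have DU_index: "DUmat U nx ny nz $$ (p,q) = (if p = q then u p else 0)"
    if "p < nodes" "q < nodes" for p q
    unfolding DUmat_def n u_def using that by simp
  have H_carrier: "H \<in> carrier_mat nodes nodes"
    using carriers DU by (auto simp: H_def Hmat_def intro!: carrier_matI)
  have H_index: "H $$ (p,q) = c * K p q + (if p = q then V $$ (p,p) * u p else 0)"
    if pq: "p < nodes" "q < nodes" for p q
  proof -
    have "(V * DUmat U nx ny nz) $$ (p,q) = (\<Sum>l<nodes. V $$ (p,l) * DUmat U nx ny nz $$ (l,q))"
      using DU carriers(4) pq by (simp add: scalar_prod_def atLeast0LessThan)
    also have "\<dots> = (\<Sum>l<nodes. if l = q then V $$ (p,q) * u q else 0)"
      by (intro sum.cong refl) (use pq in \<open>auto simp: DU_index\<close>)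
    also have "\<dots> = V $$ (p,q) * u q" using pq by simp
    also have "\<dots> = (if p = q then V $$ (p,p) * u p else 0)"
      using diagonal_V pq carriers(4) by (auto simp: diagonal_mat_def)
    finally have VU: "(V * DUmat U nx ny nz) $$ (p,q) = (if p = q then V $$ (p,p) * u p else 0)" .
    have "(G * S * diag_inv L * transpose_mat G) $$ (p,q) = K p q"
      using mult_diagonal_transpose_index[OF carriers(1-3) diagonal_S diagonal_diag_inv pq]
      by (simp add: K_def weight_def)
    then show ?thesis
      using VU pq carriers DU by (simp add: H_def Hmat_def c_def)
  qed
  have R_carrier: "R \<in> carrier_mat nodes nodes"
    using carriers(4) by (simp add: R_def diag_inv_sqrt_def)
  have R_index: "R $$ (p,q) = (if p = q then 1 / sqrt (V $$ (p,p)) else 0)"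
    if "p < nodes" "q < nodes" for p q
    using that carriers(4) by (simp add: R_def diag_inv_sqrt_def)
  have M_carrier: "M \<in> carrier_mat nodes nodes"
    using R_carrier H_carrier by (simp add: M_def)
  have M_index: "M $$ (p,q) = H $$ (p,q) / (hbar * sqrt (V $$ (p,p)) * sqrt (V $$ (q,q)))"
    if pq: "p < nodes" "q < nodes" for p q
  proof -
    have RH: "(R * H) $$ (p,l) = H $$ (p,l) / sqrt (V $$ (p,p))" if "l < nodes" for l
    proof -
      have "(R * H) $$ (p,l) = (\<Sum>k<nodes. R $$ (p,k) * H $$ (k,l))"
        using R_carrier H_carrier pq that by (simp add: scalar_prod_def atLeast0LessThan)
      also have "\<dots> = (\<Sum>k<nodes. if k = p then H $$ (p,l) / sqrt (V $$ (p,p)) else 0)"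
        using pq by (intro sum.cong refl) (auto simp: R_index)
      finally show ?thesis using pq by simp
    qed
    have "(R * H * R) $$ (p,q) = (\<Sum>k<nodes. (R * H) $$ (p,k) * R $$ (k,q))"
      using R_carrier H_carrier pq
      by (simp add: scalar_prod_def atLeast0LessThan del: assoc_mult_mat)
    also have "\<dots> = (\<Sum>k<nodes. if k = q then H $$ (p,q) / (sqrt (V $$ (p,p)) * sqrt (V $$ (q,q))) else 0)"
      using pq by (intro sum.cong refl) (auto simp: R_index RH)
    finally have "(R * H * R) $$ (p,q) = H $$ (p,q) / (sqrt (V $$ (p,p)) * sqrt (V $$ (q,q)))"
      using pq by simp
    then show ?thesis using pq R_carrier H_carrier by (simp add: M_def mult_ac)
  qed

  have nodes_pos: "0 < nodes"
    by (auto simp: nodes_def)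
  have H_row: "(\<Sum>q<nodes. \<bar>H $$ (p,q)\<bar>) \<le> hbar * r * V $$ (p,p)" if p: "p < nodes" for p
  proof -
    have "(\<Sum>q<nodes. \<bar>H $$ (p,q)\<bar>)
        \<le> (\<Sum>q<nodes. c * \<bar>K p q\<bar> + (if q = p then V $$ (p,p) * \<bar>u p\<bar> else 0))"
      using c p V_pos[OF p]
      by (intro sum_mono) (auto simp: H_index abs_mult intro: order_trans[OF abs_triangle_ineq])
    also have "\<dots> = c * (\<Sum>q<nodes. \<bar>K p q\<bar>) + V $$ (p,p) * \<bar>u p\<bar>"
      using p by (simp add: sum.distrib sum_distrib_left)
    also have "\<dots> \<le> c * (4 * V $$ (p,p) * (1/dx^2 + 1/dy^2 + 1/dz^2)) + V $$ (p,p) * umax"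
      using c V_pos[OF p] u_le[OF p] K_abs_row_sum[OF p] by (intro add_mono mult_left_mono) auto
    \<comment> \<open>Here \<open>4 * c\<close> equals \<open>hbar * (2*hbar/m)\<close>, which
      produces the kinetic summand of \<open>r\<close>; the potential bound is
      \<open>hbar * (umax / hbar)\<close>.\<close>
    also have "\<dots> = hbar * r * V $$ (p,p)"
      using assms(1,2) by (simp add: c_def r_def field_simps power2_eq_square)
    finally show ?thesis .
  qed
  have "spectral_radius (map_mat complex_of_real M) \<le> r"
  proof -
    have MC: "map_mat complex_of_real M \<in> carrier_mat nodes nodes" using M_carrier by simp
    obtain l where l: "eigenvalue (map_mat complex_of_real M) l"
        "spectral_radius (map_mat complex_of_real M) = cmod l"
      using spectral_radius_mem_max(1)[OF MC nodes_pos] by (auto simp: spectrum_def)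
    have "cmod l \<le> r"
    \<comment> \<open>The weight \<open>sqrt (V $$ (q,q))\<close> cancels the column scaling in
      \<open>M\<close>, leaving absolute row sums of \<open>H\<close> divided by
      \<open>hbar * sqrt (V $$ (p,p))\<close>. This realises the similarity with
      \<open>V\<close>-inverse times \<open>H\<close>.\<close>
    proof (rule eigenvalue_norm_le_weighted_row_sum[OF MC l(1)])
      fix p assume p: "p < nodes"
      show "0 < sqrt (V $$ (p,p))" using V_pos[OF p] by simp
      have "(\<Sum>q<nodes. cmod (map_mat complex_of_real M $$ (p,q)) * sqrt (V $$ (q,q)))
          = (\<Sum>q<nodes. \<bar>H $$ (p,q)\<bar> / (hbar * sqrt (V $$ (p,p))))"
      proof (intro sum.cong refl)
        fix q assume "q \<in> {..<nodes}"
        then have q: "q < nodes" by simp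
        have "cmod (map_mat complex_of_real M $$ (p,q)) = \<bar>M $$ (p,q)\<bar>"
          using p q M_carrier by simp
        then show "cmod (map_mat complex_of_real M $$ (p,q)) * sqrt (V $$ (q,q))
          = \<bar>H $$ (p,q)\<bar> / (hbar * sqrt (V $$ (p,p)))"
          using assms(1) V_pos[OF p] V_pos[OF q] by (simp add: M_index[OF p q] abs_mult)
      qed
      also have "\<dots> \<le> hbar * r * V $$ (p,p) / (hbar * sqrt (V $$ (p,p)))"
        unfolding sum_divide_distrib[symmetric]
        using H_row[OF p] assms(1) V_pos[OF p] by (intro divide_right_mono) auto
      also have "\<dots> = r * sqrt (V $$ (p,p))"
        using assms(1) V_pos[OF p] by (simp add: field_simps)
      finally show "(\<Sum>q<nodes. cmod (map_mat complex_of_real M $$ (p,q)) * sqrt (V $$ (q,q)))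
        \<le> r * sqrt (V $$ (p,p))" .
    qed
    then show ?thesis using l(2) by simp
  qed
  moreover have "spectral_radius (map_mat complex_of_real M) > 0"
  proof (rule spectral_radius_pos_of_symmetric[OF M_carrier])
    show "transpose_mat M = M"
      using M_carrier by (intro eq_matI) (auto simp: M_index H_index K_commute mult_ac)
    show "M \<noteq> 0\<^sub>m nodes nodes"
    proof
      assume "M = 0\<^sub>m nodes nodes"
      then have "H $$ (0,q) = 0" if "q < nodes" for q
        using M_index[OF nodes_pos that] V_pos[OF nodes_pos] V_pos[OF that] nodes_pos that assms(1) by simp
      \<comment> \<open>Only off the diagonal is \<open>H\<close> equal to \<open>c * K\<close>; the
        diagonal entry of \<open>K\<close> is then recovered from its vanishing row sum.\<close>
      then have "K 0 q = 0" if "q < nodes" "q \<noteq> 0" for q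
        using H_index[OF nodes_pos that(1)] that c by simp
      then have "(\<Sum>q<nodes. K 0 q) = (\<Sum>q<nodes. if q = 0 then K 0 0 else 0)"
        by (intro sum.cong refl) auto
      then have "K 0 0 = 0" using K_row_sum[OF nodes_pos] nodes_pos by simp
      then show False using K_diag_pos[OF nodes_pos] by simp
    qed
  qed
  \<comment> \<open>Both denominators are positive, \<open>r\<close> because it dominates a positive
    spectral radius.\<close>
  ultimately have "2 / r \<le> 2 / spectral_radius (map_mat complex_of_real M)"
    by (intro divide_left_mono) auto
  then show ?thesis
    by (simp add: dt_CFL_def dt_CFL_gen_def Let_def r_def umax_def M_def R_def H_def)
qed

end
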